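(* Let $G$ be a finite connected graph (loops and multiple edges allowed) and let $\alpha(G)$ denote the number of Eulerian equivalence classes of $\mathcal{BO}(G)$. Then $$\alpha(G)=T_G(0,1),$$ where $T_G(x,y)$ is the Tutte polynomial of $G$. Equivalently, $\alpha(G)$ equals the number of spanning trees of $G$ having no internally active edge with respect to any fixed total order on $E(G)$.
   Context: An orientation of $G=(V,E)$ assigns a direction to each edge. For a partition $V=S\sqcup T$ with $S,T\neq\emptyset$, $[S,T]$ denotes the set of edges joining $S$ and $T$ (a cut); a bond is a minimal nonempty cut. For an orientation $\varepsilon$, $(S,T)_\varepsilon$ is the set of edges of $[S,T]$ directed from $S$ to $T$. A bond $[S,T]$ is directed (relative to $\varepsilon$) if $(S,T)_\varepsilon=\emptyset$ or $(T,S)_\varepsilon=\emptyset$; a cut is directed if it is a disjoint union of directed bonds. $\mathcal{BO}(G)$ is the set of orientations of $G$ having no (nonempty) directed cut; for connected $G$ these are exactly the totally cyclic orientations (every edge lies on a directed cycle). Two orientations $\varepsilon_1,\varepsilon_2$ are Eulerian equivalent if the spanning subgraph formed by the edges $\{e:\varepsilon_1(e)\neq\varepsilon_2(e)\}$, oriented by $\varepsilon_1$, has in-degree equal to out-degree at every vertex. The Tutte polynomial is defined by $T_{E_n}=1$ for the edgeless graph $E_n$, $T_G=xT_{G/e}$ if $e$ is a bridge, $T_G=yT_{G-e}$ if $e$ is a loop, and $T_G=T_{G-e}+T_{G/e}$ otherwise. Given a total order on $E$ and a spanning tree $F$, an edge $f\in F$ is internally active if it is the smallest edge of the cut $\{e\in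 E: (F-f)+e \text{ is a spanning tree}\}$; one has $T_G(x,y)=\sum_{i,j}t_{ij}x^iy^j$ where $t_{ij}$ is the number of spanning trees with exactly $i$ internally active and $j$ externally active edges. *)

theory Defs
  imports "HOL-Library.FuncSet"
begin

text \<open>A finite multigraph (loops and parallel edges allowed): vertex set V, edge set E,
  and an endpoint map ends.  ends e = (a,b) also fixes a reference orientation a -> b.\<close>

definition multigraph :: "'v set \<Rightarrow> 'e set \<Rightarrow> ('e \<Rightarrow> 'v \<times> 'v) \<Rightarrow> bool" where
  "multigraph V E ends \<longleftrightarrow> finite V \<and> finite E \<and>
     (\<forall>e\<in>E. fst (ends e) \<in> V \<and> snd (ends e) \<in> V)"

definition adj :: "'e set \<Rightarrow> ('e \<Rightarrow> 'v \<times> 'v) \<Rightarrow> ('v \<times> 'v) set" where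
  "adj E ends = {(a,b). \<exists>e\<in>E. ends e = (a,b) \<or> ends e = (b,a)}"

definition connected_graph :: "'v set \<Rightarrow> 'e set \<Rightarrow> ('e \<Rightarrow> 'v \<times> 'v) \<Rightarrow> bool" where
  "connected_graph V E ends \<longleftrightarrow> V \<noteq> {} \<and> (\<forall>u\<in>V. \<forall>v\<in>V. (u,v) \<in> (adj E ends)\<^sup>*)"

text \<open>Orientations: eps e = True means e is directed as fst (ends e) -> snd (ends e).\<close>

definition orientations :: "'e set \<Rightarrow> ('e \<Rightarrow> bool) set" where
  "orientations E = E \<rightarrow>\<^sub>E (UNIV :: bool set)"

definition otail :: "('e \<Rightarrow> 'v \<times> 'v) \<Rightarrow> ('e \<Rightarrow> bool) \<Rightarrow> 'e \<Rightarrow> 'v" where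
  "otail ends eps e = (if eps e then fst (ends e) else snd (ends e))"

definition ohead :: "('e \<Rightarrow> 'v \<times> 'v) \<Rightarrow> ('e \<Rightarrow> bool) \<Rightarrow> 'e \<Rightarrow> 'v" where
  "ohead ends eps e = (if eps e then snd (ends e) else fst (ends e))"

text \<open>Cuts [S, V - S] for a proper nonempty S.\<close>

definition cut_of :: "'e set \<Rightarrow> ('e \<Rightarrow> 'v \<times> 'v) \<Rightarrow> 'v set \<Rightarrow> 'e set" where
  "cut_of E ends S = {e\<in>E. (fst (ends e) \<in> S) \<noteq> (snd (ends e) \<in> S)}"

definition is_cut :: "'v set \<Rightarrow> 'e set \<Rightarrow> ('e \<Rightarrow> 'v \<times> 'v) \<Rightarrow> 'e set \<Rightarrow> bool" where
  "is_cut V E ends C \<longleftrightarrow> (\<exists>S. S \<subseteq> V \<and> S \<noteq> {} \<and> S \<noteq> V \<and> C = cut_of E ends S)"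

definition is_bond :: "'v set \<Rightarrow> 'e set \<Rightarrow> ('e \<Rightarrow> 'v \<times> 'v) \<Rightarrow> 'e set \<Rightarrow> bool" where
  "is_bond V E ends B \<longleftrightarrow> is_cut V E ends B \<and> B \<noteq> {} \<and>
     (\<forall>C. is_cut V E ends C \<and> C \<noteq> {} \<and> C \<subseteq> B \<longrightarrow> C = B)"

text \<open>(S,T)_eps: edges of [S,T] directed from S to T.\<close>
definition dir_out :: "'e set \<Rightarrow> ('e \<Rightarrow> 'v \<times> 'v) \<Rightarrow> ('e \<Rightarrow> bool) \<Rightarrow> 'v set \<Rightarrow> 'e set" where
  "dir_out E ends eps S = {e \<in> cut_of E ends S. otail ends eps e \<in> S}"

definition directed_bond ::
  "'v set \<Rightarrow> 'e set \<Rightarrow> ('e \<Rightarrow> 'v \<times> 'v) \<Rightarrow> ('e \<Rightarrow> bool) \<Rightarrow> 'e set \<Rightarrow> bool" where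
  "directed_bond V E ends eps B \<longleftrightarrow> is_bond V E ends B \<and>
     (\<exists>S. S \<subseteq> V \<and> S \<noteq> {} \<and> S \<noteq> V \<and> B = cut_of E ends S \<and>
          (dir_out E ends eps S = {} \<or> dir_out E ends eps (V - S) = {}))"

definition directed_cut ::
  "'v set \<Rightarrow> 'e set \<Rightarrow> ('e \<Rightarrow> 'v \<times> 'v) \<Rightarrow> ('e \<Rightarrow> bool) \<Rightarrow> 'e set \<Rightarrow> bool" where
  "directed_cut V E ends eps C \<longleftrightarrow> is_cut V E ends C \<and>
     (\<exists>\<B>. (\<forall>B\<in>\<B>. directed_bond V E ends eps B) \<and> pairwise disjnt \<B> \<and> \<Union>\<B> = C)"

definition BO :: "'v set \<Rightarrow> 'e set \<Rightarrow> ('e \<Rightarrow> 'v \<times> 'v) \<Rightarrow> ('e \<Rightarrow> bool) set" where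
  "BO V E ends = {eps \<in> orientations E. \<not> (\<exists>C. C \<noteq> {} \<and> directed_cut V E ends eps C)}"

definition eulerian_equiv ::
  "'v set \<Rightarrow> 'e set \<Rightarrow> ('e \<Rightarrow> 'v \<times> 'v) \<Rightarrow> ('e \<Rightarrow> bool) \<Rightarrow> ('e \<Rightarrow> bool) \<Rightarrow> bool" where
  "eulerian_equiv V E ends eps1 eps2 \<longleftrightarrow>
     (let D = {e\<in>E. eps1 e \<noteq> eps2 e} in
      \<forall>v\<in>V. card {e\<in>D. ohead ends eps1 e = v} = card {e\<in>D. otail ends eps1 e = v})"

definition alpha :: "'v set \<Rightarrow> 'e set \<Rightarrow> ('e \<Rightarrow> 'v \<times> 'v) \<Rightarrow> nat" where
  "alpha V E ends = card (BO V E ends //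
     {(a,b). a \<in> BO V E ends \<and> b \<in> BO V E ends \<and> eulerian_equiv V E ends a b})"

text \<open>Tutte polynomial evaluated at (x,y), by deletion--contraction.  At each step an
  arbitrary edge (Hilbert choice) is processed; it is a standard fact that the result does
  not depend on the choices.  Contraction of e with ends (u,w) identifies w with u.
  Isolated vertices do not influence T_G, so only the edges are tracked.\<close>

definition contract_ends :: "('e \<Rightarrow> 'v \<times> 'v) \<Rightarrow> 'e \<Rightarrow> 'e \<Rightarrow> 'v \<times> 'v" where
  "contract_ends ends e = (let (u,w) = ends e; m = (\<lambda>z. if z = w then u else z)
                           in (\<lambda>f. (m (fst (ends f)), m (snd (ends f)))))"

definition is_loop :: "('e \<Rightarrow> 'v \<times> 'v) \<Rightarrow> 'e \<Rightarrow> bool" where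
  "is_loop ends e \<longleftrightarrow> fst (ends e) = snd (ends e)"

definition is_bridge :: "'e set \<Rightarrow> ('e \<Rightarrow> 'v \<times> 'v) \<Rightarrow> 'e \<Rightarrow> bool" where
  "is_bridge E ends e \<longleftrightarrow> e \<in> E \<and> \<not> is_loop ends e \<and>
     (fst (ends e), snd (ends e)) \<notin> (adj (E - {e}) ends)\<^sup>*"

fun tutte_aux :: "nat \<Rightarrow> int \<Rightarrow> int \<Rightarrow> 'e set \<Rightarrow> ('e \<Rightarrow> 'v \<times> 'v) \<Rightarrow> int" where
  "tutte_aux 0 x y E ends = 1"
| "tutte_aux (Suc n) x y E ends =
     (if E = {} then 1 else
      (let e = (SOME e. e \<in> E) in
       if is_bridge E ends e then x * tutte_aux n x y (E - {e}) (contract_ends ends e)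
       else if is_loop ends e then y * tutte_aux n x y (E - {e}) ends
       else tutte_aux n x y (E - {e}) ends + tutte_aux n x y (E - {e}) (contract_ends ends e)))"

definition tutte :: "'e set \<Rightarrow> ('e \<Rightarrow> 'v \<times> 'v) \<Rightarrow> int \<Rightarrow> int \<Rightarrow> int" where
  "tutte E ends x y = tutte_aux (card E) x y E ends"

end

theory Submission
  imports Defs
begin

text \<open>Two orientations are Eulerian equivalent iff they have the same outdegrees, and for a connected
  graph \<open>BO(G)\<close> consists of the orientations in which an edge leaves every proper nonempty vertex set.
  By Hakimi's criterion, \<open>\<alpha>(G)\<close> is therefore the number of integer vectors \<open>d\<close> on \<open>V\<close> with \<open>d(V) = |E|\<close>
  and \<open>d(S) > |E[S]|\<close> for all proper nonempty \<open>S\<close>. For an edge \<open>e = uw\<close> that is neither a loop nor a bridge, the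
  vectors of \<open>G\<close> and of \<open>G - e\<close> over a fixed vector of \<open>G/e\<close> are determined by \<open>d(w)\<close>, and the admissible
  values of \<open>d(w)\<close> form intervals \<open>[a, b]\<close> and \<open>[a, b - 1]\<close> with \<open>a \<le> b\<close>. Hence the count satisfies the
  deletion-contraction recursion of \<open>T(0,1)\<close>.\<close>

subsection \<open>Outdegree vectors\<close>

definition inner :: "'e set \<Rightarrow> ('e \<Rightarrow> 'v \<times> 'v) \<Rightarrow> 'v set \<Rightarrow> 'e set" where
  "inner E ends S = {e \<in> E. fst (ends e) \<in> S \<and> snd (ends e) \<in> S}"

text \<open>Since \<open>S\<close> also ranges over complements, in a multigraph edges both leave
  and enter every proper nonempty \<open>S\<close>: this is strong connectivity in cut form.\<close>

definition strong :: "'v set \<Rightarrow> 'e set \<Rightarrow> ('e \<Rightarrow> 'v \<times> 'v) \<Rightarrow> ('e \<Rightarrow> bool) \<Rightarrow> bool" where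
  "strong V E ends eps \<longleftrightarrow> (\<forall>S. S \<subseteq> V \<and> S \<noteq> {} \<and> S \<noteq> V \<longrightarrow> dir_out E ends eps S \<noteq> {})"

definition outdegree :: "'v set \<Rightarrow> 'e set \<Rightarrow> ('e \<Rightarrow> 'v \<times> 'v) \<Rightarrow> ('e \<Rightarrow> bool) \<Rightarrow> 'v \<Rightarrow> int" where
  "outdegree V E ends eps v = (if v \<in> V then int (card {e \<in> E. otail ends eps e = v}) else 0)"

text \<open>Being 0 off \<open>V\<close> makes each vector a unique function, so that the
  cardinality of this set counts vectors on \<open>V\<close>. The strict inequality encodes that
  some edge leaves \<open>S\<close>.\<close>

definition strong_vectors :: "'v set \<Rightarrow> 'e set \<Rightarrow> ('e \<Rightarrow> 'v \<times> 'v) \<Rightarrow> ('v \<Rightarrow> int) set" where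
  "strong_vectors V E ends = {d. (\<forall>v. v \<notin> V \<longrightarrow> d v = 0) \<and> sum d V = int (card E) \<and>
     (\<forall>S. S \<subseteq> V \<and> S \<noteq> {} \<and> S \<noteq> V \<longrightarrow> int (card (inner E ends S)) < sum d S)}"

lemma finite_inner [simp]: "finite E \<Longrightarrow> finite (inner E ends S)"
  by (simp add: inner_def)

lemma inner_eq_self: "multigraph V E ends \<Longrightarrow> inner E ends V = E"
  by (auto simp: multigraph_def inner_def)

text \<open>The right side gains exactly the edges between \<open>S - T\<close> and
  \<open>T - S\<close>, which lie inside the union only.\<close>

lemma card_inner_supermodular:
  assumes "finite E"
  shows "card (inner E ends S) + card (inner E ends T)
    \<le> card (inner E ends (S \<union> T)) + card (inner E ends (S \<inter> T))"
proof -
  let ?I = "inner E ends"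
  have "card (?I S) + card (?I T) = card (?I S \<union> ?I T) + card (?I S \<inter> ?I T)"
    using assms by (intro card_Un_Int) auto
  moreover have "?I S \<inter> ?I T = ?I (S \<inter> T)" by (auto simp: inner_def)
  moreover have "card (?I S \<union> ?I T) \<le> card (?I (S \<union> T))"
    using assms by (intro card_mono) (auto simp: inner_def)
  ultimately show ?thesis by simp
qed

lemma card_inner_supermodular_strict:
  assumes "finite E" "e \<in> inner E ends (S \<union> T)" "e \<notin> inner E ends S" "e \<notin> inner E ends T"
  shows "card (inner E ends S) + card (inner E ends T)
    < card (inner E ends (S \<union> T)) + card (inner E ends (S \<inter> T))"
proof -
  let ?I = "inner E ends"
  have "card (?I S) + card (?I T) = card (?I S \<union> ?I T) + card (?I S \<inter> ?I T)"
    using assms by (intro card_Un_Int) auto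
  moreover have "?I S \<inter> ?I T = ?I (S \<inter> T)" by (auto simp: inner_def)
  moreover have "?I S \<union> ?I T \<subset> ?I (S \<union> T)"
    using assms by (auto simp: inner_def)
  then have "card (?I S \<union> ?I T) < card (?I (S \<union> T))"
    using assms by (intro psubset_card_mono) auto
  ultimately show ?thesis by simp
qed

lemma card_inner_insert:
  assumes "finite E" "e \<notin> E"
  shows "card (inner (insert e E) ends S)
    = card (inner E ends S) + (if fst (ends e) \<in> S \<and> snd (ends e) \<in> S then 1 else 0)"
proof -
  have "inner (insert e E) ends S
     = (if fst (ends e) \<in> S \<and> snd (ends e) \<in> S then insert e (inner E ends S) else inner E ends S)"
    by (auto simp: inner_def)
  moreover have "e \<notin> inner E ends S" using assms by (simp add: inner_def)
  ultimately show ?thesis using assms by simp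
qed

lemma sum_fun_upd_add:
  fixes d :: "'v \<Rightarrow> int"
  assumes "finite S"
  shows "sum (d(x := d x + c)) S = sum d S + (if x \<in> S then c else 0)"
proof -
  have "sum (d(x := d x + c)) S = (\<Sum>y\<in>S. d y + (if y = x then c else 0))"
    by (rule sum.cong) auto
  then show ?thesis using assms by (simp add: sum.distrib)
qed

section \<open>Hakimi's criterion and the outdegree vectors of strong orientations\<close>

text \<open>Induction on the edges: some end of the new edge can be its tail, that is, lowering
  \<open>d\<close> by one there keeps all inequalities for the remaining edges.\<close>

lemma orientation_with_outdegree:
  fixes d :: "'v \<Rightarrow> int"
  assumes "finite E" "finite V" "\<And>e. e \<in> E \<Longrightarrow> fst (ends e) \<in> V \<and> snd (ends e) \<in> V"
    and "\<And>S. S \<subseteq> V \<Longrightarrow> int (card (inner E ends S)) \<le> sum d S"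
    and "sum d V = int (card E)"
  shows "\<exists>eps. \<forall>v\<in>V. d v = int (card {e \<in> E. otail ends eps e = v})"
  using assms(1,3-)
proof (induction E arbitrary: d rule: finite_induct)
  case empty
  have "0 \<le> d v" if "v \<in> V" for v
    using empty(2)[of "{v}"] that by (simp add: inner_def)
  then show ?case using empty(3) \<open>finite V\<close> by (simp add: sum_nonneg_eq_0_iff)
next
  case (insert e E)
  let ?a = "fst (ends e)" and ?b = "snd (ends e)"
  have ab: "?a \<in> V" "?b \<in> V" using insert.prems(1) by auto
  have low: "int (card (inner E ends S)) + (if ?a \<in> S \<and> ?b \<in> S then 1 else 0) \<le> sum d S"
    if "S \<subseteq> V" for S
    using insert.prems(2)[OF that] card_inner_insert[OF insert.hyps, of ends S] by auto
  \<comment> \<open>An end \<open>x\<close> is ruled out only by a set containing \<open>x\<close>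
    that is tight without \<open>e\<close>. Such a set cannot contain both ends, because
    \<open>low\<close> leaves it a spare unit in that case.\<close>
  have tight: "\<exists>S. S \<subseteq> V \<and> x \<in> S \<and> \<not> (?a \<in> S \<and> ?b \<in> S) \<and> sum d S = int (card (inner E ends S))"
    if x: "x \<in> {?a, ?b}" and neg: "\<not> (\<forall>S\<subseteq>V. int (card (inner E ends S)) \<le> sum (d(x := d x + (-1))) S)" for x
  proof -
    obtain S where S: "S \<subseteq> V" "sum (d(x := d x + (-1))) S < int (card (inner E ends S))"
      using neg by (meson not_le)
    have "finite S" using S(1) \<open>finite V\<close> finite_subset by blast
    from sum_fun_upd_add[OF this, of d x "-1"] S low[OF S(1)]
    have "x \<in> S \<and> \<not> (?a \<in> S \<and> ?b \<in> S) \<and> sum d S = int (card (inner E ends S))"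
      by (auto split: if_splits)
    with S(1) show ?thesis by blast
  qed
  \<comment> \<open>If neither end can serve as the tail of \<open>e\<close>, two tight sets, each containing just one end,
    contradict supermodularity because \<open>e\<close> lies inside their union.\<close>
  have "\<exists>x\<in>{?a, ?b}. \<forall>S\<subseteq>V. int (card (inner E ends S)) \<le> sum (d(x := d x + (-1))) S"
  proof (rule ccontr)
    assume neg: "\<not> ?thesis"
    obtain S where S: "S \<subseteq> V" "?a \<in> S" "?b \<notin> S" "sum d S = int (card (inner E ends S))"
      using tight[of ?a] neg by auto
    obtain T where T: "T \<subseteq> V" "?b \<in> T" "?a \<notin> T" "sum d T = int (card (inner E ends T))"
      using tight[of ?b] neg by auto
    have fin: "finite S" "finite T" using S(1) T(1) \<open>finite V\<close> finite_subset by blast+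
    have "sum d S + sum d T = sum d (S \<union> T) + sum d (S \<inter> T)"
      using fin by (simp add: sum.union_inter)
    moreover have "int (card (inner E ends (S \<union> T))) + 1 \<le> sum d (S \<union> T)"
      using low[of "S \<union> T"] S T by auto
    moreover have "int (card (inner E ends (S \<inter> T))) \<le> sum d (S \<inter> T)"
      using low[of "S \<inter> T"] S T by auto
    ultimately show False
      using card_inner_supermodular[OF insert.hyps(1), of ends S T] S(4) T(4) by linarith
  qed
  then obtain x where x: "x = ?a \<or> x = ?b"
    "\<And>S. S \<subseteq> V \<Longrightarrow> int (card (inner E ends S)) \<le> sum (d(x := d x + (-1))) S" by blast
  have "sum (d(x := d x + (-1))) V = int (card E)"
    using insert.prems(3) insert.hyps ab x(1) sum_fun_upd_add[OF \<open>finite V\<close>, of d x "-1"] by auto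
  with insert.IH[of "d(x := d x + (-1))"] x(2) insert.prems(1)
  obtain eps where eps: "\<forall>v\<in>V. (d(x := d x + (-1))) v = int (card {f \<in> E. otail ends eps f = v})"
    by blast
  \<comment> \<open>If \<open>x = ?a\<close> fails then \<open>x = ?b\<close>, so the tail of
    \<open>e\<close> is \<open>x\<close> in either case; a loop gets \<open>True\<close>.\<close>
  define eps' where "eps' = eps(e := (x = ?a))"
  have tail_e: "otail ends eps' e = x" using x(1) by (auto simp: eps'_def otail_def)
  have "d v = int (card {f \<in> insert e E. otail ends eps' f = v})" if "v \<in> V" for v
  proof -
    have same: "otail ends eps' f = otail ends eps f" if "f \<in> E" for f
      using that insert.hyps by (auto simp: eps'_def otail_def)
    have "{f \<in> insert e E. otail ends eps' f = v}
      = (if v = x then insert e {f \<in> E. otail ends eps f = v} else {f \<in> E. otail ends eps f = v})"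
      using same tail_e by auto
    moreover have "int (card {f \<in> E. otail ends eps f = v}) = (if v = x then d v - 1 else d v)"
      using eps[rule_format, OF that] by (auto split: if_splits)
    ultimately show ?thesis using insert.hyps by (auto split: if_splits)
  qed
  then show ?case by blast
qed

text \<open>An edge with its tail in \<open>S\<close> either stays inside \<open>S\<close> or leaves
  it.\<close>

lemma sum_outdegree:
  assumes "finite E" "finite V" "S \<subseteq> V"
  shows "sum (outdegree V E ends eps) S
    = int (card (inner E ends S)) + int (card (dir_out E ends eps S))"
proof -
  have "sum (outdegree V E ends eps) S = (\<Sum>v\<in>S. int (card {e \<in> E. otail ends eps e = v}))"
    using assms by (intro sum.cong) (auto simp: outdegree_def)
  also have "\<dots> = int (card (\<Union>v\<in>S. {e \<in> E. otail ends eps e = v}))"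
    using assms finite_subset by (subst card_UN_disjoint) auto
  also have "(\<Union>v\<in>S. {e \<in> E. otail ends eps e = v}) = inner E ends S \<union> dir_out E ends eps S"
    by (auto simp: inner_def dir_out_def cut_of_def otail_def)
  also have "card \<dots> = card (inner E ends S) + card (dir_out E ends eps S)"
    using assms by (intro card_Un_disjoint) (auto simp: inner_def dir_out_def cut_of_def)
  finally show ?thesis by simp
qed

text \<open>By \<open>sum_outdegree\<close>, strict inequality at \<open>S\<close> means that
  \<open>dir_out\<close> is nonempty there; Hakimi's criterion supplies an orientation for each
  vector.\<close>

lemma outdegree_image_strong:
  assumes "multigraph V E ends"
  shows "outdegree V E ends ` {eps \<in> orientations E. strong V E ends eps} = strong_vectors V E ends"
    (is "?L = ?R")
proof
  have fin: "finite V" "finite E" using assms by (auto simp: multigraph_def)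
  have total: "sum (outdegree V E ends eps) V = int (card E)" for eps
  proof -
    have "dir_out E ends eps V = {}"
      using assms by (auto simp: dir_out_def cut_of_def multigraph_def)
    then show ?thesis using sum_outdegree[OF fin(2,1), of V] inner_eq_self[OF assms] by simp
  qed
  show "?L \<subseteq> ?R"
  proof
    fix d assume "d \<in> ?L"
    then obtain eps where d: "d = outdegree V E ends eps" and "strong V E ends eps" by blast
    have "int (card (inner E ends S)) < sum d S" if "S \<subseteq> V" "S \<noteq> {}" "S \<noteq> V" for S
    proof -
      have "dir_out E ends eps S \<noteq> {}" using \<open>strong V E ends eps\<close> that by (auto simp: strong_def)
      moreover have "finite (dir_out E ends eps S)" using fin by (simp add: dir_out_def cut_of_def)
      ultimately have "card (dir_out E ends eps S) > 0" by (simp add: card_gt_0_iff)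
      then show ?thesis using sum_outdegree[OF fin(2,1) that(1), of ends eps] d by simp
    qed
    then show "d \<in> ?R" using total d by (auto simp: strong_vectors_def outdegree_def)
  qed
  show "?R \<subseteq> ?L"
  proof
    fix d assume d: "d \<in> ?R"
    have "int (card (inner E ends S)) \<le> sum d S" if "S \<subseteq> V" for S
    proof (cases "S = {} \<or> S = V")
      case True
      then show ?thesis using d inner_eq_self[OF assms] by (auto simp: strong_vectors_def inner_def)
    next
      case False
      then have "int (card (inner E ends S)) < sum d S" using that d by (simp add: strong_vectors_def)
      then show ?thesis by simp
    qed
    with orientation_with_outdegree[of E V ends d] fin assms d
    obtain eps where eps: "\<forall>v\<in>V. d v = int (card {e \<in> E. otail ends eps e = v})"
      by (auto simp: strong_vectors_def multigraph_def)
    \<comment> \<open>Members of \<open>orientations E\<close> are extensional, and values off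
      \<open>E\<close> do not affect tails.\<close>
    let ?eps = "restrict eps E"
    have "{e \<in> E. otail ends ?eps e = v} = {e \<in> E. otail ends eps e = v}" for v
      by (auto simp: otail_def)
    then have deg: "d = outdegree V E ends ?eps"
      using d eps by (auto simp: outdegree_def fun_eq_iff strong_vectors_def)
    have "strong V E ends ?eps"
      unfolding strong_def
    proof (intro allI impI notI)
      fix S assume S: "S \<subseteq> V \<and> S \<noteq> {} \<and> S \<noteq> V" and "dir_out E ends ?eps S = {}"
      then have "sum d S = int (card (inner E ends S))"
        using sum_outdegree[OF fin(2,1), of S ends ?eps] by (simp flip: deg)
      moreover have "int (card (inner E ends S)) < sum d S"
        using d S by (simp add: strong_vectors_def)
      ultimately show False by simp
    qed
    moreover have "?eps \<in> orientations E" by (simp add: orientations_def)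
    ultimately show "d \<in> ?L" using deg by blast
  qed
qed

lemma finite_strong_vectors:
  assumes "multigraph V E ends"
  shows "finite (strong_vectors V E ends)"
proof -
  have "finite (orientations E)"
    using assms by (auto simp: orientations_def multigraph_def intro!: finite_PiE)
  then show ?thesis by (simp flip: outdegree_image_strong[OF assms])
qed

subsection \<open>Orientations without directed cuts\<close>

lemma cut_of_nonempty:
  assumes "connected_graph V E ends" "S \<subseteq> V" "S \<noteq> {}" "S \<noteq> V"
  shows "cut_of E ends S \<noteq> {}"
proof
  assume empty: "cut_of E ends S = {}"
  obtain a b where ab: "a \<in> S" "b \<in> V" "b \<notin> S" using assms by blast
  then have "(a, b) \<in> (adj E ends)\<^sup>*" using assms by (auto simp: connected_graph_def)
  then have "b \<in> S"
  proof (induction rule: rtrancl_induct)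
    case base show ?case by fact
  next
    case (step y z)
    then show ?case using empty by (force simp: adj_def cut_of_def)
  qed
  with ab show False by blast
qed

lemma exists_directed_bond:
  assumes mg: "multigraph V E ends" and con: "connected_graph V E ends"
    and S0: "S0 \<subseteq> V" "S0 \<noteq> {}" "S0 \<noteq> V" "dir_out E ends eps S0 = {}"
  shows "\<exists>B. directed_bond V E ends eps B"
proof -
  \<comment> \<open>A directed cut of least cardinality is a bond: a smaller cut inside it would split one of its
    two sides into parts whose cuts are directed, disjoint and contained in the given one.\<close>
  define P where "P S \<longleftrightarrow> S \<subseteq> V \<and> S \<noteq> {} \<and> S \<noteq> V \<and> dir_out E ends eps S = {}" for S
  define m where "m = (\<lambda>S. card (cut_of E ends S))"
  obtain S where S: "P S" and min: "\<And>T. P T \<Longrightarrow> m S \<le> m T"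
    using S0 exists_least_iff[of "\<lambda>n. \<exists>S. P S \<and> m S = n"] unfolding P_def
    by (metis (mono_tags, lifting) linorder_not_less)
  have finE: "finite E" and inV: "\<And>e. e \<in> E \<Longrightarrow> fst (ends e) \<in> V \<and> snd (ends e) \<in> V"
    using mg by (auto simp: multigraph_def)
  have fin: "finite (cut_of E ends T)" for T using finE by (simp add: cut_of_def)
  have cut_compl: "cut_of E ends (V - T) = cut_of E ends T" for T
    using inV by (auto simp: cut_of_def)
  \<comment> \<open>A set and its complement have the same cut, so minimality extends to sets whose
    complement satisfies \<open>P\<close>.\<close>
  define Q where "Q R \<longleftrightarrow> P R \<or> P (V - R)" for R
  have minQ: "m S \<le> m T" if "Q T" for T
    using that min[of T] min[of "V - T"] cut_compl by (auto simp: Q_def m_def)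
  \<comment> \<open>Here \<open>R\<close> is a side of the minimal cut. If \<open>T\<close> split
    \<open>R\<close>, no edge inside \<open>R\<close> could join the two pieces, since it would lie
    in the cut of \<open>T\<close> but not in that of \<open>R\<close>. The pieces would then have
    disjoint cuts within the cut of \<open>S\<close>, each of size at least
    \<open>m S > 0\<close>.\<close>
  have sides: "R \<inter> T = {} \<or> R \<subseteq> T"
    if R: "R \<subseteq> V" "Q R" "cut_of E ends R = cut_of E ends S"
      and T: "cut_of E ends T \<subseteq> cut_of E ends S" for R T
  proof (rule ccontr)
    let ?A = "R \<inter> T" and ?B = "R - T"
    assume "\<not> ?thesis"
    then have ne: "?A \<noteq> {}" "?B \<noteq> {}" by auto
    have no: "fst (ends e) \<in> ?A \<longleftrightarrow> snd (ends e) \<in> ?A" "fst (ends e) \<in> ?B \<longleftrightarrow> snd (ends e) \<in> ?B"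
      if "e \<in> E" "fst (ends e) \<in> R" "snd (ends e) \<in> R" for e
      using that T unfolding R(3)[symmetric] by (auto simp: cut_of_def)
    have Q: "Q X" if "X = ?A \<or> X = ?B" for X
    proof -
      have X: "X \<noteq> {}" "X \<subseteq> R" using that ne by auto
      have noX: "fst (ends e) \<in> X \<longleftrightarrow> snd (ends e) \<in> X"
        if "e \<in> E" "fst (ends e) \<in> R" "snd (ends e) \<in> R" for e
        using no[OF that] \<open>X = ?A \<or> X = ?B\<close> by blast
      from R(2) show ?thesis unfolding Q_def
      proof
        assume "P R"
        moreover have "dir_out E ends eps X \<subseteq> dir_out E ends eps R"
          using X noX by (auto simp: dir_out_def cut_of_def otail_def split: if_splits)
        ultimately show "P X \<or> P (V - X)" using X by (auto simp: P_def)
      next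
        assume PR: "P (V - R)"
        moreover have "dir_out E ends eps (V - X) \<subseteq> dir_out E ends eps (V - R)"
          using X noX inV by (auto simp: dir_out_def cut_of_def otail_def split: if_splits)
        ultimately show "P X \<or> P (V - X)" using X R(1) unfolding P_def by blast
      qed
    qed
    have "cut_of E ends ?A \<union> cut_of E ends ?B \<subseteq> cut_of E ends S"
      unfolding R(3)[symmetric] using no by (auto simp: cut_of_def)
    moreover have "cut_of E ends ?A \<inter> cut_of E ends ?B = {}"
      using no by (auto simp: cut_of_def)
    ultimately have "m ?A + m ?B \<le> m S"
      unfolding m_def by (metis card_Un_disjoint card_mono fin)
    moreover have "m S \<le> m ?A" "m S \<le> m ?B" using minQ Q by auto
    moreover have "m S > 0"
      using cut_of_nonempty[OF con, of S] S fin by (simp add: P_def m_def card_gt_0_iff)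
    ultimately show False by linarith
  qed
  have "is_bond V E ends (cut_of E ends S)"
    unfolding is_bond_def
  proof (intro conjI allI impI)
    show "is_cut V E ends (cut_of E ends S)" using S by (auto simp: is_cut_def P_def)
    show "cut_of E ends S \<noteq> {}" using cut_of_nonempty[OF con, of S] S by (simp add: P_def)
    fix C assume C: "is_cut V E ends C \<and> C \<noteq> {} \<and> C \<subseteq> cut_of E ends S"
    then obtain T where T: "T \<subseteq> V" "T \<noteq> {}" "T \<noteq> V" "C = cut_of E ends T"
      by (auto simp: is_cut_def)
    have SV: "S \<subseteq> V" using S by (simp add: P_def)
    have "S \<inter> T = {} \<or> S \<subseteq> T"
      using sides[of S T] S SV C T by (auto simp: Q_def)
    moreover have "(V - S) \<inter> T = {} \<or> V - S \<subseteq> T"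
      using sides[of "V - S" T] S SV C T cut_compl[of S] by (auto simp: Q_def double_diff)
    \<comment> \<open>Of the four combinations, the other two give the excluded
      \<open>T = {}\<close> and \<open>T = V\<close>.\<close>
    ultimately have "T = S \<or> T = V - S" using SV T by blast
    then show "C = cut_of E ends S" using T cut_compl by auto
  qed
  then show ?thesis using S unfolding directed_bond_def P_def by blast
qed

text \<open>A nonempty directed cut contains a directed bond, which violates \<open>strong\<close>
  at one of its sides. Conversely a violating set yields a directed bond, which is a directed cut by
  itself.\<close>

lemma BO_eq_strong:
  assumes "multigraph V E ends" "connected_graph V E ends"
  shows "BO V E ends = {eps \<in> orientations E. strong V E ends eps}"
proof -
  have "(\<exists>C. C \<noteq> {} \<and> directed_cut V E ends eps C) \<longleftrightarrow> \<not> strong V E ends eps" for eps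
  proof
    assume "\<exists>C. C \<noteq> {} \<and> directed_cut V E ends eps C"
    then obtain B where "directed_bond V E ends eps B" unfolding directed_cut_def by blast
    then obtain S where S: "S \<subseteq> V" "S \<noteq> {}" "S \<noteq> V"
      "dir_out E ends eps S = {} \<or> dir_out E ends eps (V - S) = {}"
      unfolding directed_bond_def by blast
    then have "V - S \<subseteq> V" "V - S \<noteq> {}" "V - S \<noteq> V" by auto
    with S show "\<not> strong V E ends eps" unfolding strong_def by blast
  next
    assume "\<not> strong V E ends eps"
    then obtain B where "directed_bond V E ends eps B"
      using exists_directed_bond[OF assms] unfolding strong_def by blast
    then have "B \<noteq> {} \<and> directed_cut V E ends eps B"
      unfolding directed_cut_def
      by (auto simp: directed_bond_def is_bond_def intro!: exI[of _ "{B}"])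
    then show "\<exists>C. C \<noteq> {} \<and> directed_cut V E ends eps C" by blast
  qed
  then show ?thesis by (simp add: BO_def)
qed

section \<open>Eulerian classes as outdegree vectors\<close>

text \<open>Edges directed alike contribute equally to both outdegrees; on the others, the heads
  under \<open>eps1\<close> are the tails under \<open>eps2\<close>.\<close>

lemma eulerian_equiv_iff_outdegree:
  assumes "finite E"
  shows "eulerian_equiv V E ends eps1 eps2 \<longleftrightarrow> outdegree V E ends eps1 = outdegree V E ends eps2"
proof -
  let ?D = "{e \<in> E. eps1 e \<noteq> eps2 e}"
  have split: "card {e \<in> E. otail ends eps e = v}
    = card {e \<in> E - ?D. otail ends eps e = v} + card {e \<in> ?D. otail ends eps e = v}" for eps v
    using assms by (subst card_Un_disjoint[symmetric]) (auto intro!: arg_cong[of _ _ card])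
  have same: "{e \<in> E - ?D. otail ends eps2 e = v} = {e \<in> E - ?D. otail ends eps1 e = v}" for v
    by (auto simp: otail_def)
  have flip: "{e \<in> ?D. otail ends eps2 e = v} = {e \<in> ?D. ohead ends eps1 e = v}" for v
    by (auto simp: otail_def ohead_def)
  have "card {e \<in> ?D. ohead ends eps1 e = v} = card {e \<in> ?D. otail ends eps1 e = v}
    \<longleftrightarrow> card {e \<in> E. otail ends eps1 e = v} = card {e \<in> E. otail ends eps2 e = v}" for v
    using split[of eps1 v] split[of eps2 v] unfolding same flip by linarith
  then show ?thesis by (auto simp: eulerian_equiv_def Let_def outdegree_def fun_eq_iff)
qed

text \<open>The classes are the nonempty fibres of \<open>f\<close>, one for each value.\<close>

lemma card_quotient_kernel:
  "card (A // {(a, b). a \<in> A \<and> b \<in> A \<and> f a = f b}) = card (f ` A)"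
proof -
  let ?g = "\<lambda>y. {b \<in> A. f b = y}"
  have "A // {(a, b). a \<in> A \<and> b \<in> A \<and> f a = f b} = ?g ` f ` A"
    by (auto simp: quotient_def image_image image_iff eq_commute[of "f _" "f _"])
  moreover have "inj_on ?g (f ` A)" by (rule inj_onI) auto
  ultimately show ?thesis by (simp add: card_image)
qed

lemma alpha_eq_card_strong_vectors:
  assumes "multigraph V E ends" "connected_graph V E ends"
  shows "alpha V E ends = card (strong_vectors V E ends)"
proof -
  have "finite E" using assms by (simp add: multigraph_def)
  then show ?thesis
    unfolding alpha_def eulerian_equiv_iff_outdegree[OF \<open>finite E\<close>] card_quotient_kernel
    by (simp add: BO_eq_strong[OF assms] outdegree_image_strong[OF assms(1)])
qed

subsection \<open>Deletion and contraction\<close>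

text \<open>The graph is a single vertex, which has no proper nonempty subset, so only the total 0
  constrains \<open>d\<close>.\<close>

lemma strong_vectors_edgeless:
  assumes "connected_graph V {} ends"
  shows "card (strong_vectors V {} ends) = 1"
proof -
  have "adj {} ends = {}" by (auto simp: adj_def)
  then obtain v where "V = {v}" using assms by (auto simp: connected_graph_def)
  then have "strong_vectors V {} ends = {\<lambda>_. 0}"
    by (auto simp: strong_vectors_def fun_eq_iff inner_def subset_singleton_iff)
  then show ?thesis by simp
qed

text \<open>A loop at \<open>u\<close> lies inside exactly the sets containing \<open>u\<close>, so
  raising \<open>d u\<close> by one shifts both sides of every condition alike.\<close>

lemma strong_vectors_loop:
  assumes "multigraph V E ends" "e \<in> E" "is_loop ends e"
  shows "card (strong_vectors V E ends) = card (strong_vectors V (E - {e}) ends)"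
proof -
  let ?u = "fst (ends e)"
  have fin: "finite V" "finite (E - {e})" and u: "?u \<in> V" "snd (ends e) = ?u"
    using assms by (auto simp: multigraph_def is_loop_def)
  have E: "E = insert e (E - {e})" using assms by auto
  have inner: "card (inner E ends S) = card (inner (E - {e}) ends S) + (if ?u \<in> S then 1 else 0)" for S
    using card_inner_insert[OF fin(2), of e ends S] E u by auto
  have card: "card E = card (E - {e}) + 1" using E fin by (metis card_Suc_Diff1 Suc_eq_plus1 assms(2) finite_insert)
  have sub: "finite S" if "S \<subseteq> V" for S using that fin finite_subset by blast
  have mem: "d(?u := d ?u + 1) \<in> strong_vectors V E ends \<longleftrightarrow> d \<in> strong_vectors V (E - {e}) ends"
    (is "?d \<in> _ \<longleftrightarrow> _") for d
  proof -
    have sums: "sum ?d S = sum d S + (if ?u \<in> S then 1 else 0)" if "S \<subseteq> V" for S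
      using sum_fun_upd_add[OF sub[OF that]] .
    have "int (card (inner E ends S)) < sum ?d S \<longleftrightarrow> int (card (inner (E - {e}) ends S)) < sum d S"
      if "S \<subseteq> V" for S
      using sums[OF that] inner[of S] by auto
    moreover have "sum ?d V = int (card E) \<longleftrightarrow> sum d V = int (card (E - {e}))"
      using sums[of V] card u by auto
    moreover have "(\<forall>v. v \<notin> V \<longrightarrow> ?d v = 0) \<longleftrightarrow> (\<forall>v. v \<notin> V \<longrightarrow> d v = 0)"
      using u(1) by (metis fun_upd_apply)
    ultimately show ?thesis unfolding strong_vectors_def mem_Collect_eq by blast
  qed
  have "bij_betw (\<lambda>d. d(?u := d ?u + 1)) (strong_vectors V (E - {e}) ends) (strong_vectors V E ends)"
  proof (rule bij_betwI[where g = "\<lambda>d. d(?u := d ?u - 1)"])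
    show "(\<lambda>d. d(?u := d ?u - 1)) \<in> strong_vectors V E ends \<rightarrow> strong_vectors V (E - {e}) ends"
    proof
      fix d assume "d \<in> strong_vectors V E ends"
      then show "d(?u := d ?u - 1) \<in> strong_vectors V (E - {e}) ends"
        using mem[of "d(?u := d ?u - 1)"] by simp
    qed
  qed (use mem in auto)
  then show ?thesis by (simp add: bij_betw_same_card)
qed

text \<open>Let \<open>S\<close> be the side of \<open>u\<close> once the bridge is removed. All
  other edges lie inside \<open>S\<close> or \<open>V - S\<close>, so the two strict inequalities
  would force a total of at least \<open>card E + 1\<close>.\<close>

lemma strong_vectors_bridge:
  assumes "multigraph V E ends" "is_bridge E ends e"
  shows "strong_vectors V E ends = {}"
proof (rule ccontr)
  assume "\<not> ?thesis"
  then obtain d where d: "d \<in> strong_vectors V E ends" by blast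
  let ?u = "fst (ends e)" and ?w = "snd (ends e)"
  have e: "e \<in> E" "(?u, ?w) \<notin> (adj (E - {e}) ends)\<^sup>*" using assms by (auto simp: is_bridge_def)
  have lt: "int (card (inner E ends S)) < sum d S" if "S \<subseteq> V" "S \<noteq> {}" "S \<noteq> V" for S
    using d that by (simp add: strong_vectors_def)
  have fin: "finite V" "finite E" and inV: "\<And>f. f \<in> E \<Longrightarrow> fst (ends f) \<in> V \<and> snd (ends f) \<in> V"
    using assms by (auto simp: multigraph_def)
  define S where "S = {v \<in> V. (?u, v) \<in> (adj (E - {e}) ends)\<^sup>*}"
  have S: "S \<subseteq> V" "?u \<in> S" "?w \<notin> S" "?w \<in> V" using e inV by (auto simp: S_def)
  have "fst (ends f) \<in> S \<longleftrightarrow> snd (ends f) \<in> S" if "f \<in> E - {e}" for f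
  proof -
    have "(fst (ends f), snd (ends f)) \<in> adj (E - {e}) ends" "(snd (ends f), fst (ends f)) \<in> adj (E - {e}) ends"
      using that by (auto simp: adj_def intro!: bexI[of _ f])
    then show ?thesis using that inV by (auto simp: S_def intro: rtrancl_into_rtrancl)
  qed
  then have "E - {e} \<subseteq> inner E ends S \<union> inner E ends (V - S)"
    using inV by (auto simp: inner_def)
  then have "card (E - {e}) \<le> card (inner E ends S \<union> inner E ends (V - S))"
    using fin by (intro card_mono) auto
  also have "\<dots> \<le> card (inner E ends S) + card (inner E ends (V - S))" by (rule card_Un_le)
  finally have "card E \<le> card (inner E ends S) + card (inner E ends (V - S)) + 1"
    using e fin by simp
  moreover have "int (card (inner E ends S)) < sum d S"
    by (rule lt) (use S in auto)
  moreover have "int (card (inner E ends (V - S))) < sum d (V - S)"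
    by (rule lt) (use S in auto)
  moreover have "sum d (V - S) + sum d S = int (card E)"
    using d S fin by (simp add: strong_vectors_def sum.subset_diff[of S V, symmetric])
  ultimately show False by linarith
qed

section \<open>Contracting and deleting an edge\<close>

lemma contract_ends_eq:
  assumes "ends e = (u, w)"
  shows "contract_ends ends e f
    = ((if fst (ends f) = w then u else fst (ends f)), (if snd (ends f) = w then u else snd (ends f)))"
  using assms by (simp add: contract_ends_def)

text \<open>Vertex sets of the contraction correspond to the sets that contain both or neither of
  \<open>u\<close> and \<open>w\<close>.\<close>

lemma inner_contract:
  assumes "ends e = (u, w)" "u \<noteq> w" "w \<notin> S"
  shows "inner E (contract_ends ends e) S = inner E ends (if u \<in> S then insert w S else S)"
  using assms by (auto simp: inner_def contract_ends_eq split: if_splits)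

lemma multigraph_contract:
  assumes "multigraph V E ends" "e \<in> E" "ends e = (u, w)" "u \<noteq> w"
  shows "multigraph (V - {w}) (E - {e}) (contract_ends ends e)"
  using assms by (auto simp: multigraph_def contract_ends_eq dest: bspec[of _ _ e])

text \<open>Merging \<open>w\<close> into \<open>u\<close> maps paths to paths; a step along
  \<open>e\<close> becomes stationary.\<close>

lemma connected_contract:
  assumes "multigraph V E ends" "connected_graph V E ends" "e \<in> E" "ends e = (u, w)" "u \<noteq> w"
  shows "connected_graph (V - {w}) (E - {e}) (contract_ends ends e)"
proof -
  let ?m = "\<lambda>z. if z = w then u else z"
  let ?R = "adj (E - {e}) (contract_ends ends e)"
  have edge: "(?m a, ?m b) \<in> ?R\<^sup>*" if ab: "(a, b) \<in> adj E ends" for a b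
  proof -
    obtain f where f: "f \<in> E" "ends f = (a, b) \<or> ends f = (b, a)" using ab by (auto simp: adj_def)
    show ?thesis
    proof (cases "f = e")
      case True
      then show ?thesis using f assms(4) by auto
    next
      case False
      have "contract_ends ends e f = (?m a, ?m b) \<or> contract_ends ends e f = (?m b, ?m a)"
        using f(2) by (elim disjE) (simp_all add: contract_ends_eq[of ends e, OF assms(4)])
      then have "(?m a, ?m b) \<in> ?R"
        unfolding adj_def using f(1) False by blast
      then show ?thesis by blast
    qed
  qed
  have path: "(?m a, ?m b) \<in> ?R\<^sup>*" if "(a, b) \<in> (adj E ends)\<^sup>*" for a b
    using that
  proof (induction rule: rtrancl_induct)
    case (step y z)
    then show ?case using edge[of y z] by (meson rtrancl_trans)
  qed simp
  have "u \<in> V" using assms by (auto simp: multigraph_def dest: bspec[of _ _ e])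
  moreover have "(a, b) \<in> ?R\<^sup>*" if "a \<in> V - {w}" "b \<in> V - {w}" for a b
    using path[of a b] that assms(2) by (auto simp: connected_graph_def)
  ultimately show ?thesis using assms(5) by (auto simp: connected_graph_def)
qed

text \<open>Each step along \<open>e\<close> is replaced by the given path or its reverse.\<close>

lemma connected_delete:
  assumes "connected_graph V E ends" "(fst (ends e), snd (ends e)) \<in> (adj (E - {e}) ends)\<^sup>*"
  shows "connected_graph V (E - {e}) ends"
proof -
  let ?R = "adj (E - {e}) ends"
  have "sym ?R" by (auto simp: sym_def adj_def)
  then have backward: "(snd (ends e), fst (ends e)) \<in> ?R\<^sup>*"
    using assms(2) by (meson sym_rtrancl symD)
  have "adj E ends \<subseteq> ?R\<^sup>*"
  proof
    fix p assume "p \<in> adj E ends"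
    then obtain a b f where f: "p = (a, b)" "f \<in> E" "ends f = (a, b) \<or> ends f = (b, a)"
      by (auto simp: adj_def)
    show "p \<in> ?R\<^sup>*"
    proof (cases "f = e")
      case True
      then show ?thesis using f assms(2) backward by auto
    next
      case False
      then have "p \<in> ?R" using f by (auto simp: adj_def)
      then show ?thesis by blast
    qed
  qed
  then have "(adj E ends)\<^sup>* \<subseteq> ?R\<^sup>*" by (rule rtrancl_subset_rtrancl)
  then show ?thesis using assms(1) by (auto simp: connected_graph_def)
qed

section \<open>Fibres over the vectors of the contraction\<close>

text \<open>Splits the value of the merged vertex: \<open>w\<close> receives \<open>k\<close>, and
  \<open>u\<close> keeps the rest plus \<open>c\<close>, the contribution of the contracted
  edge.\<close>

definition lift_vector :: "'v \<Rightarrow> 'v \<Rightarrow> int \<Rightarrow> ('v \<Rightarrow> int) \<Rightarrow> int \<Rightarrow> 'v \<Rightarrow> int" where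
  "lift_vector u w c d k = d(w := k, u := d u + c - k)"

text \<open>The vectors counted for \<open>G\<close> (\<open>c = 1\<close>) and for \<open>G - e\<close> (\<open>c = 0\<close>), where \<open>e\<close> joins \<open>u\<close>
  and \<open>w\<close> and \<open>E\<close> is the edge set without \<open>e\<close>.\<close>

definition padded_vectors ::
  "'v set \<Rightarrow> 'e set \<Rightarrow> ('e \<Rightarrow> 'v \<times> 'v) \<Rightarrow> 'v \<Rightarrow> 'v \<Rightarrow> int \<Rightarrow> ('v \<Rightarrow> int) set" where
  "padded_vectors V E ends u w c = {d. (\<forall>v. v \<notin> V \<longrightarrow> d v = 0) \<and> sum d V = int (card E) + c \<and>
     (\<forall>S. S \<subseteq> V \<and> S \<noteq> {} \<and> S \<noteq> V \<longrightarrow>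
        int (card (inner E ends S)) + (if u \<in> S \<and> w \<in> S then c else 0) < sum d S)}"

text \<open>Only sets separating \<open>u\<close> from \<open>w\<close> restrict the split value
  \<open>k\<close>.\<close>

definition lift_range ::
  "'v set \<Rightarrow> 'e set \<Rightarrow> ('e \<Rightarrow> 'v \<times> 'v) \<Rightarrow> 'v \<Rightarrow> 'v \<Rightarrow> int \<Rightarrow> ('v \<Rightarrow> int) \<Rightarrow> int set" where
  "lift_range V E ends u w c d = {k.
     (\<forall>S. S \<subseteq> V \<and> w \<in> S \<and> u \<notin> S \<longrightarrow> int (card (inner E ends S)) < sum d S + k) \<and>
     (\<forall>S. S \<subseteq> V \<and> u \<in> S \<and> w \<notin> S \<longrightarrow> int (card (inner E ends S)) < sum d S + c - k)}"

lemma padded_vectors_0: "padded_vectors V E ends u w 0 = strong_vectors V E ends"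
  by (simp add: padded_vectors_def strong_vectors_def)

lemma padded_vectors_1:
  assumes "finite E" "e \<in> E" "ends e = (u, w)"
  shows "padded_vectors V (E - {e}) ends u w 1 = strong_vectors V E ends"
proof -
  have E: "insert e (E - {e}) = E" using assms by auto
  have "int (card (inner E ends S))
    = int (card (inner (E - {e}) ends S)) + (if u \<in> S \<and> w \<in> S then 1 else 0)" for S
    using card_inner_insert[of "E - {e}" e ends S] assms unfolding E by auto
  moreover have "int (card E) = int (card (E - {e})) + 1"
    using assms by (metis card_Suc_Diff1 of_nat_Suc add.commute)
  ultimately show ?thesis by (simp add: padded_vectors_def strong_vectors_def)
qed

lemma sum_lift_vector:
  assumes "finite S" "d w = 0" "u \<noteq> w"
  shows "sum (lift_vector u w c d k) S
    = sum d S + (if w \<in> S then k else 0) + (if u \<in> S then c - k else 0)"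
proof -
  define d1 where "d1 = d(w := d w + k)"
  have "lift_vector u w c d k = d1(u := d1 u + (c - k))"
    using assms by (auto simp: lift_vector_def d1_def fun_eq_iff)
  then show ?thesis using assms(1) by (simp add: sum_fun_upd_add d1_def del: fun_upd_apply)
qed

text \<open>On a set with both or neither of \<open>u\<close> and \<open>w\<close> the value
  \<open>k\<close> cancels, leaving a condition on the contraction; the separating sets give
  \<open>lift_range\<close>.\<close>

lemma lift_vector_mem_iff:
  assumes "finite V" "u \<in> V" "w \<in> V" "u \<noteq> w" "d w = 0"
    and inner': "\<And>S. w \<notin> S \<Longrightarrow> inner E ends' S = inner E ends (if u \<in> S then insert w S else S)"
  shows "lift_vector u w c d k \<in> padded_vectors V E ends u w c
    \<longleftrightarrow> d \<in> strong_vectors (V - {w}) E ends' \<and> k \<in> lift_range V E ends u w c d"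
    (is "?l \<in> ?P \<longleftrightarrow> _")
proof -
  have fin: "finite S" if "S \<subseteq> V" for S using that assms(1) finite_subset by blast
  have suml: "sum ?l S = sum d S + (if w \<in> S then k else 0) + (if u \<in> S then c - k else 0)"
    if "S \<subseteq> V" for S
    using sum_lift_vector[OF fin[OF that], of d w u c k] assms by blast
  have drop: "sum d (S - {w}) = sum d S" if "S \<subseteq> V" for S
    using fin[OF that] \<open>d w = 0\<close> by (simp add: sum_diff1)
  have supp: "(\<forall>v. v \<notin> V \<longrightarrow> ?l v = 0) \<longleftrightarrow> (\<forall>v. v \<notin> V - {w} \<longrightarrow> d v = 0)"
    using assms(2-5) by (auto simp: lift_vector_def)
  have total: "sum ?l V = int (card E) + c \<longleftrightarrow> sum d (V - {w}) = int (card E)"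
    using suml[of V] drop[of V] assms by auto
  let ?I = "\<lambda>S. int (card (inner E ends S))"
  have "(\<forall>S. S \<subseteq> V \<and> S \<noteq> {} \<and> S \<noteq> V \<longrightarrow> ?I S + (if u \<in> S \<and> w \<in> S then c else 0) < sum ?l S)
    \<longleftrightarrow> (\<forall>S. S \<subseteq> V - {w} \<and> S \<noteq> {} \<and> S \<noteq> V - {w} \<longrightarrow> int (card (inner E ends' S)) < sum d S)
      \<and> k \<in> lift_range V E ends u w c d" (is "?L \<longleftrightarrow> ?R1 \<and> ?R2")
  proof (intro iffI conjI)
    assume L: ?L
    show ?R1
    proof (intro allI impI)
      fix S assume S: "S \<subseteq> V - {w} \<and> S \<noteq> {} \<and> S \<noteq> V - {w}"
      define T where "T = (if u \<in> S then insert w S else S)"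
      have T: "T \<subseteq> V" "T \<noteq> {}" "T \<noteq> V" "u \<in> T \<longleftrightarrow> w \<in> T" "T - {w} = S" "w \<notin> S"
        using S assms(2-4) by (auto simp: T_def split: if_splits)
      have "?I T < sum d T"
        using L[rule_format, of T] suml[OF T(1)] T(1-4) by (simp split: if_splits)
      moreover have "inner E ends' S = inner E ends T" unfolding T_def by (rule inner'[OF T(6)])
      ultimately show "int (card (inner E ends' S)) < sum d S"
        using drop[OF T(1)] T(5) by simp
    qed
    show ?R2
      unfolding lift_range_def
    proof (intro CollectI conjI allI impI)
      fix S assume S: "S \<subseteq> V \<and> w \<in> S \<and> u \<notin> S"
      then have "S \<noteq> {}" "S \<noteq> V" using assms(2) by auto
      with S show "?I S < sum d S + k" using L[rule_format, of S] suml[of S] by simp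
    next
      fix S assume S: "S \<subseteq> V \<and> u \<in> S \<and> w \<notin> S"
      then have "S \<noteq> {}" "S \<noteq> V" using assms(3) by auto
      with S show "?I S < sum d S + c - k" using L[rule_format, of S] suml[of S] by simp
    qed
  next
    assume R: "?R1 \<and> ?R2"
    show ?L
    proof (intro allI impI)
      fix S assume S: "S \<subseteq> V \<and> S \<noteq> {} \<and> S \<noteq> V"
      have same: "?I S < sum d S" if "u \<in> S \<longleftrightarrow> w \<in> S"
      proof -
        \<comment> \<open>Nonempty because \<open>S = {w}\<close> would contain \<open>w\<close> but
          not \<open>u\<close>.\<close>
        have "S - {w} \<subseteq> V - {w} \<and> S - {w} \<noteq> {} \<and> S - {w} \<noteq> V - {w}"
          using S that assms by auto
        with R have "int (card (inner E ends' (S - {w}))) < sum d (S - {w})" by blast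
        moreover have "(if u \<in> S - {w} then insert w (S - {w}) else S - {w}) = S"
          using that assms by auto
        ultimately show ?thesis using inner'[of "S - {w}"] drop[of S] S by simp
      qed
      have "?I S < sum d S + k" if "w \<in> S" "u \<notin> S"
        using R S that by (simp add: lift_range_def)
      moreover have "?I S < sum d S + c - k" if "u \<in> S" "w \<notin> S"
        using R S that by (simp add: lift_range_def)
      ultimately show "?I S + (if u \<in> S \<and> w \<in> S then c else 0) < sum ?l S"
        using same suml[of S] S by auto
    qed
  qed
  then show ?thesis
    unfolding padded_vectors_def strong_vectors_def using supp total by blast
qed

lemma bij_betw_lift_vector:
  assumes "finite V" "u \<in> V" "w \<in> V" "u \<noteq> w"
    and inner': "\<And>S. w \<notin> S \<Longrightarrow> inner E ends' S = inner E ends (if u \<in> S then insert w S else S)"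
  shows "bij_betw (\<lambda>(d, k). lift_vector u w c d k)
    (SIGMA d : strong_vectors (V - {w}) E ends'. lift_range V E ends u w c d)
    (padded_vectors V E ends u w c)"
\<comment> \<open>The inverse reads \<open>k\<close> off at \<open>w\<close> and gives the merged
  vertex both values less \<open>c\<close>.\<close>
proof (rule bij_betwI[where g = "\<lambda>d. (d(w := 0, u := d u + d w - c), d w)"])
  note mem = lift_vector_mem_iff[OF assms(1-4) _ inner']
  have w0: "d w = 0" if "d \<in> strong_vectors (V - {w}) E ends'" for d
    using that by (simp add: strong_vectors_def)
  show "(\<lambda>(d, k). lift_vector u w c d k)
    \<in> (SIGMA d : strong_vectors (V - {w}) E ends'. lift_range V E ends u w c d)
      \<rightarrow> padded_vectors V E ends u w c"
    using mem w0 by auto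
  have backward: "lift_vector u w c (d(w := 0, u := d u + d w - c)) (d w) = d" for d
    using assms by (auto simp: lift_vector_def fun_eq_iff)
  show "(\<lambda>d. (d(w := 0, u := d u + d w - c), d w))
    \<in> padded_vectors V E ends u w c
      \<rightarrow> (SIGMA d : strong_vectors (V - {w}) E ends'. lift_range V E ends u w c d)"
  proof
    fix d assume "d \<in> padded_vectors V E ends u w c"
    then show "(d(w := 0, u := d u + d w - c), d w)
      \<in> (SIGMA d : strong_vectors (V - {w}) E ends'. lift_range V E ends u w c d)"
      using mem[of "d(w := 0, u := d u + d w - c)" c "d w"] assms(4) backward[of d] by simp
  qed
  show "(case (case x of (d, k) \<Rightarrow> lift_vector u w c d k) of
      d \<Rightarrow> (d(w := 0, u := d u + d w - c), d w)) = x"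
    if "x \<in> (SIGMA d : strong_vectors (V - {w}) E ends'. lift_range V E ends u w c d)" for x
    using that assms w0 by (auto simp: lift_vector_def fun_eq_iff)
  show "(case (d(w := 0, u := d u + d w - c), d w) of (d, k) \<Rightarrow> lift_vector u w c d k) = d" for d
    using backward by simp
qed

text \<open>The bounds \<open>a\<close> and \<open>b\<close> are independent of \<open>c\<close>, so
  passing from \<open>c = 0\<close> to \<open>c = 1\<close> adds exactly one value of
  \<open>k\<close>; \<open>a \<le> b\<close> ensures this even when the range for
  \<open>c = 0\<close> is empty.\<close>

lemma lift_range_intervals:
  assumes mg: "multigraph V E ends" and uw: "u \<in> V" "w \<in> V" "u \<noteq> w"
    and path: "(u, w) \<in> (adj E ends)\<^sup>*"
    and inner': "\<And>S. w \<notin> S \<Longrightarrow> inner E ends' S = inner E ends (if u \<in> S then insert w S else S)"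
    and d: "d \<in> strong_vectors (V - {w}) E ends'"
  shows "\<exists>a b. a \<le> b \<and> (\<forall>c. lift_range V E ends u w c d = {a..<b + c})"
proof -
  let ?I = "\<lambda>S. int (card (inner E ends S))"
  define W where "W = {S. S \<subseteq> V \<and> w \<in> S \<and> u \<notin> S}"
  define U where "U = {S. S \<subseteq> V \<and> u \<in> S \<and> w \<notin> S}"
  \<comment> \<open>Over the integers, \<open>?I S < sum d S + k\<close> reads
    \<open>k \<ge> ?I S + 1 - sum d S\<close>; likewise sets in \<open>U\<close> demand
    \<open>k < sum d S - ?I S + c\<close>.\<close>
  define a where "a = Max ((\<lambda>S. ?I S + 1 - sum d S) ` W)"
  define b where "b = Min ((\<lambda>S. sum d S - ?I S) ` U)"
  have finV: "finite V" and finE: "finite E" using mg by (auto simp: multigraph_def)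
  have fin: "finite S" if "S \<subseteq> V" for S using that finV finite_subset by blast
  have ne: "W \<noteq> {}" "U \<noteq> {}" using uw by (auto simp: W_def U_def)
  have finWU: "finite W" "finite U"
    using finV by (auto simp: W_def U_def intro: finite_subset[OF _ finite_Pow_iff[THEN iffD2]])
  have "lift_range V E ends u w c d = {a..<b + c}" for c
  proof -
    have "k \<in> lift_range V E ends u w c d \<longleftrightarrow> k \<in> {a..<b + c}" for k
    proof -
      have "a \<le> k \<longleftrightarrow> (\<forall>S\<in>W. ?I S < sum d S + k)"
        unfolding a_def using finWU ne by (subst Max_le_iff) (auto simp: algebra_simps)
      moreover have "k - c + 1 \<le> b \<longleftrightarrow> (\<forall>S\<in>U. ?I S < sum d S + c - k)"
        unfolding b_def using finWU ne by (subst Min_ge_iff) (auto simp: algebra_simps)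
      moreover have "k \<in> {a..<b + c} \<longleftrightarrow> a \<le> k \<and> k - c + 1 \<le> b" by auto
      ultimately show ?thesis unfolding lift_range_def W_def U_def by blast
    qed
    then show ?thesis by (rule set_eqI)
  qed
  \<comment> \<open>One unit of slack beyond supermodularity is required. The union, which contains
    \<open>u\<close> and \<open>w\<close>, supplies it unless it is \<open>V\<close>; the
    intersection, which contains neither, supplies it unless it is empty.\<close>
  moreover have "?I S + 1 - sum d S \<le> sum d T - ?I T" if "S \<in> W" "T \<in> U" for S T
  proof -
    have ST: "S \<subseteq> V" "w \<in> S" "u \<notin> S" "T \<subseteq> V" "u \<in> T" "w \<notin> T"
      using that by (auto simp: W_def U_def)
    have dw: "d w = 0" and dV: "sum d (V - {w}) = int (card E)"
      using d by (auto simp: strong_vectors_def)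
    have dlt: "int (card (inner E ends' X)) < sum d X" if "X \<subseteq> V - {w}" "X \<noteq> {}" "X \<noteq> V - {w}" for X
      using that d by (simp add: strong_vectors_def)
    have modular: "sum d S + sum d T = sum d (S \<union> T) + sum d (S \<inter> T)"
      using ST fin by (simp add: sum.union_inter)
    have super: "?I S + ?I T \<le> ?I (S \<union> T) + ?I (S \<inter> T)"
      using card_inner_supermodular[OF finE, of ends S T] by linarith
    have drop: "sum d (S \<union> T - {w}) = sum d (S \<union> T)"
      using ST fin dw by (simp add: sum_diff1)
    have union: "?I (S \<union> T) + (if S \<union> T = V then 0 else 1) \<le> sum d (S \<union> T)"
    proof (cases "S \<union> T = V")
      case True
      then show ?thesis using drop dV inner_eq_self[OF mg] by simp
    next
      case False
      have "insert w (S \<union> T - {w}) = S \<union> T" using ST by auto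
      moreover have "u \<in> S \<union> T - {w}" using ST by auto
      moreover have "S \<union> T - {w} \<subseteq> V - {w}" "S \<union> T - {w} \<noteq> {}" "S \<union> T - {w} \<noteq> V - {w}"
        using False ST by blast+
      ultimately show ?thesis
        using False dlt[of "S \<union> T - {w}"] inner'[of "S \<union> T - {w}"] drop by simp
    qed
    have inter: "?I (S \<inter> T) + (if S \<inter> T = {} then 0 else 1) \<le> sum d (S \<inter> T)"
    proof (cases "S \<inter> T = {}")
      case True
      then show ?thesis by (simp add: inner_def)
    next
      case False
      moreover have "S \<inter> T \<subseteq> V - {w}" "S \<inter> T \<noteq> V - {w}" using ST uw by blast+
      ultimately show ?thesis using dlt[of "S \<inter> T"] inner'[of "S \<inter> T"] ST by simp
    qed
    show ?thesis
    proof (cases "S \<union> T = V \<and> S \<inter> T = {}")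
      case False
      then show ?thesis using modular super union inter by (auto split: if_splits)
    next
      case True
      \<comment> \<open>Here \<open>S\<close> and \<open>T\<close> are complementary, and the missing unit is an edge of the cut
        between them, crossed by the path from \<open>u\<close> to \<open>w\<close>.\<close>
      have "\<exists>f\<in>E. (fst (ends f) \<in> T) \<noteq> (snd (ends f) \<in> T)"
      proof (rule ccontr)
        assume none: "\<not> ?thesis"
        from path have "w \<in> T"
        proof (induction rule: rtrancl_induct)
          case base show ?case using ST by simp
        next
          case (step y z)
          then show ?case using none by (force simp: adj_def)
        qed
        then show False using ST by simp
      qed
      then obtain f where f: "f \<in> E" "(fst (ends f) \<in> T) \<noteq> (snd (ends f) \<in> T)" by blast
      have fV: "fst (ends f) \<in> V" "snd (ends f) \<in> V" using f mg by (auto simp: multigraph_def)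
      have "card (inner E ends S) + card (inner E ends T)
        < card (inner E ends (S \<union> T)) + card (inner E ends (S \<inter> T))"
        by (rule card_inner_supermodular_strict[OF finE, of f])
          (use f fV True in \<open>auto simp: inner_def\<close>)
      then show ?thesis using modular union inter by (auto split: if_splits)
    qed
  qed
  then have "a \<le> b"
    unfolding a_def b_def using finWU ne by (subst Max_le_iff) (auto simp: Min_ge_iff)
  ultimately show ?thesis by blast
qed

text \<open>Both counts are sums of fibre sizes over the vectors of \<open>G/e\<close>, and each
  fibre for \<open>G\<close> has one more element than that for \<open>G - e\<close>. That
  \<open>e\<close> is no bridge provides the path required for \<open>a \<le> b\<close>.\<close>

lemma strong_vectors_delete_contract:
  assumes mg: "multigraph V E ends" and e: "e \<in> E" "\<not> is_loop ends e" "\<not> is_bridge E ends e"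
    and ends: "ends e = (u, w)"
  shows "card (strong_vectors V E ends) = card (strong_vectors V (E - {e}) ends)
    + card (strong_vectors (V - {w}) (E - {e}) (contract_ends ends e))"
proof -
  let ?E = "E - {e}" and ?ends = "contract_ends ends e"
  let ?D = "strong_vectors (V - {w}) ?E ?ends"
  have uw: "u \<in> V" "w \<in> V" "u \<noteq> w" and path: "(u, w) \<in> (adj ?E ends)\<^sup>*"
    using mg e ends by (auto simp: multigraph_def is_loop_def is_bridge_def dest: bspec[of _ _ e])
  have finV: "finite V" and finE: "finite E" using mg by (auto simp: multigraph_def)
  have mg': "multigraph V ?E ends" using mg by (auto simp: multigraph_def)
  note inner' = inner_contract[of ends e, OF ends uw(3)]
  have finD: "finite ?D"
    using multigraph_contract[OF mg e(1) ends uw(3)] by (rule finite_strong_vectors)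
  obtain a b where ab: "\<And>d. d \<in> ?D \<Longrightarrow> a d \<le> b d"
    "\<And>d c. d \<in> ?D \<Longrightarrow> lift_range V ?E ends u w c d = {a d..<b d + c}"
    using lift_range_intervals[OF mg' uw path inner'] by metis
  have card: "card (padded_vectors V ?E ends u w c) = (\<Sum>d\<in>?D. nat (b d + c - a d))" for c
  proof -
    have "card (padded_vectors V ?E ends u w c)
      = card (SIGMA d : ?D. lift_range V ?E ends u w c d)"
      using bij_betw_same_card[OF bij_betw_lift_vector[OF finV uw inner', where E = ?E and c = c]] by simp
    also have "\<dots> = (\<Sum>d\<in>?D. card (lift_range V ?E ends u w c d))"
      using finD ab by (intro card_SigmaI) auto
    finally show ?thesis using ab by simp
  qed
  \<comment> \<open>\<open>nat (b d + 1 - a d) = nat (b d - a d) + 1\<close> relies on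
    \<open>a d \<le> b d\<close>.\<close>
  have "card (strong_vectors V E ends) = (\<Sum>d\<in>?D. nat (b d - a d) + 1)"
    unfolding padded_vectors_1[of E e ends, OF finE e(1) ends, symmetric] card
    by (intro sum.cong refl) (use ab(1) in fastforce)
  also have "\<dots> = card (strong_vectors V ?E ends) + card ?D"
    unfolding sum.distrib using card[of 0] by (simp add: padded_vectors_0)
  finally show ?thesis .
qed

section \<open>The recursion for the Tutte polynomial at (0,1)\<close>

text \<open>The counting recursions hold for every edge, hence for the one picked by
  \<open>SOME\<close>. The induction generalises \<open>V\<close> and \<open>ends\<close> because
  contraction changes both.\<close>

lemma card_strong_vectors_eq_tutte_aux:
  assumes "multigraph V E ends" "connected_graph V E ends" "card E = n"
  shows "int (card (strong_vectors V E ends)) = tutte_aux n 0 1 E ends"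
  using assms
proof (induction n arbitrary: V E ends)
  case 0
  then have "E = {}" by (simp add: multigraph_def)
  then show ?case using 0 strong_vectors_edgeless by simp
next
  case (Suc n)
  define e where "e = (SOME e. e \<in> E)"
  have "E \<noteq> {}" using Suc.prems(3) by auto
  then have e: "e \<in> E" unfolding e_def by (simp add: some_in_eq)
  obtain u w where ends: "ends e = (u, w)" by fastforce
  have mg': "multigraph V (E - {e}) ends" using Suc.prems(1) by (auto simp: multigraph_def)
  have card': "card (E - {e}) = n" using e Suc.prems(3) by simp
  have unfold: "tutte_aux (Suc n) 0 1 E ends =
    (if is_bridge E ends e then 0
     else if is_loop ends e then tutte_aux n 0 1 (E - {e}) ends
     else tutte_aux n 0 1 (E - {e}) ends + tutte_aux n 0 1 (E - {e}) (contract_ends ends e))"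
    using \<open>E \<noteq> {}\<close> by (simp add: e_def Let_def)
  \<comment> \<open>A loop is covered too: its ends coincide, so the path avoiding it is
    trivial.\<close>
  have con': "connected_graph V (E - {e}) ends" if "\<not> is_bridge E ends e"
    using that e Suc.prems(2) by (intro connected_delete) (auto simp: is_bridge_def is_loop_def simp del: prod.collapse)
  consider "is_bridge E ends e" | "\<not> is_bridge E ends e" "is_loop ends e"
    | "\<not> is_bridge E ends e" "\<not> is_loop ends e" by blast
  then show ?case
  proof cases
    case 1
    then show ?thesis using strong_vectors_bridge[OF Suc.prems(1)] unfold by simp
  next
    case 2
    then show ?thesis
      using strong_vectors_loop[OF Suc.prems(1) e] Suc.IH[OF mg' con' card'] unfold by simp
  next
    case 3
    then have "u \<noteq> w" using ends by (simp add: is_loop_def)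
    have "int (card (strong_vectors (V - {w}) (E - {e}) (contract_ends ends e)))
      = tutte_aux n 0 1 (E - {e}) (contract_ends ends e)"
      using multigraph_contract[OF Suc.prems(1) e ends \<open>u \<noteq> w\<close>]
        connected_contract[OF Suc.prems(1,2) e ends \<open>u \<noteq> w\<close>] card' by (rule Suc.IH)
    then show ?thesis
      using strong_vectors_delete_contract[OF Suc.prems(1) e 3(2,1) ends]
        Suc.IH[OF mg' con'[OF 3(1)] card'] 3 unfold by simp
  qed
qed

theorem theorem1:
  fixes V :: "'v set" and E :: "'e set" and ends :: "'e \<Rightarrow> 'v \<times> 'v"
  assumes "multigraph V E ends"
    and "connected_graph V E ends"
  shows "int (alpha V E ends) = tutte E ends 0 1"
  using card_strong_vectors_eq_tutte_aux[OF assms refl] alpha_eq_card_strong_vectors[OF assms]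
  by (simp add: tutte_def)

end
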